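(* Let $G$ be a simple graph with vertex set $V(G)=\{v_1,\dots,v_n\}$, $n\ge 2$, and $m$ edges, let $S\subseteq V(G)$ with $|S|=\sigma$, and let $G_S$ be the graph obtained from $G$ by attaching one self-loop at each vertex of $S$. Let $\lambda_1,\dots,\lambda_n$ be the adjacency eigenvalues of $G_S$, indexed so that $\left|\lambda_1-\frac{\sigma}{n}\right|\ge \left|\lambda_2-\frac{\sigma}{n}\right|\ge\dots\ge\left|\lambda_n-\frac{\sigma}{n}\right|$. Then $$E(G_S)\le \sqrt{n\left(2m+\sigma-\frac{\sigma^2}{n}\right)-\frac{n}{2}\left(\left|\lambda_1-\frac{\sigma}{n}\right|-\left|\lambda_n-\frac{\sigma}{n}\right|\right)^2}.$$
   Context: The adjacency matrix $A(G_S)=[a_{ij}]$ is the $n\times n$ symmetric $0/1$ matrix with, for $i\ne j$, $a_{ij}=1$ iff $v_i,v_j$ are adjacent, and $a_{ii}=1$ iff $v_i\in S$. Its eigenvalues are the adjacency eigenvalues of $G_S$. The energy of $G_S$ is $E(G_S)=\sum_{i=1}^n\left|\lambda_i-\frac{\sigma}{n}\right|$. Here $m$ counts only the edges of the simple graph $G$ (self-loops are not counted in $m$). *)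

theory Defs
  imports "Jordan_Normal_Form.Char_Poly"
begin

definition simple_graph :: "'a set \<Rightarrow> 'a set set \<Rightarrow> bool" where
  "simple_graph V E \<longleftrightarrow> finite V \<and> (\<forall>e\<in>E. e \<subseteq> V \<and> card e = 2)"

text \<open>
  A graph with self-loops is given by the edge set \<open>E\<close> of the underlying simple graph together
  with the set \<open>S\<close> of vertices carrying a loop.  Vertices are enumerated as \<open>v 1, \<dots>, v n\<close>, whereas
  matrix indices start at 0, so row \<open>i\<close> belongs to \<open>v (Suc i)\<close>.
\<close>

definition adjacency_matrix :: "nat \<Rightarrow> (nat \<Rightarrow> 'a) \<Rightarrow> 'a set set \<Rightarrow> 'a set \<Rightarrow> real mat" where
  "adjacency_matrix n v E S =
     mat n n (\<lambda>(i, j). if i = j then (if v (Suc i) \<in> S then 1 else 0)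
                        else (if {v (Suc i), v (Suc j)} \<in> E then 1 else 0))"

text \<open>
  The eigenvalues with algebraic multiplicity.  The matrix is real symmetric, so its
  characteristic polynomial splits over the reals and there are exactly \<open>n\<close> of them; see
  \<open>size_adjacency_eigenvalues\<close> below.
\<close>

definition adjacency_eigenvalues ::
  "nat \<Rightarrow> (nat \<Rightarrow> 'a) \<Rightarrow> 'a set set \<Rightarrow> 'a set \<Rightarrow> real multiset" where
  "adjacency_eigenvalues n v E S = proots (char_poly (adjacency_matrix n v E S))"

definition energy :: "nat \<Rightarrow> (nat \<Rightarrow> 'a) \<Rightarrow> 'a set set \<Rightarrow> 'a set \<Rightarrow> real" where
  "energy n v E S =
     (\<Sum>x\<in>#adjacency_eigenvalues n v E S. \<bar>x - real (card S) / real n\<bar>)"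

lemma adjacency_matrix_carrier: "adjacency_matrix n v E S \<in> carrier_mat n n"
  by (simp add: adjacency_matrix_def)

lemma adjacency_matrix_symmetric:
  "i < n \<Longrightarrow> j < n \<Longrightarrow> adjacency_matrix n v E S $$ (i, j) = adjacency_matrix n v E S $$ (j, i)"
  by (auto simp: adjacency_matrix_def insert_commute)

lemma symmetric_eigenvalue_real:
  fixes A :: "real mat"
  assumes A: "A \<in> carrier_mat n n"
    and sym: "\<And>i j. i < n \<Longrightarrow> j < n \<Longrightarrow> A $$ (i, j) = A $$ (j, i)"
    and ev: "eigenvalue (map_mat complex_of_real A) c"
  shows "c \<in> \<real>"
proof -
  obtain x where x: "x \<in> carrier_vec n" "x \<noteq> 0\<^sub>v n"
    and eq: "map_mat complex_of_real A *\<^sub>v x = c \<cdot>\<^sub>v x"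
    using ev A unfolding eigenvalue_def eigenvector_def by auto
  define Q where "Q = (\<Sum>i<n. \<Sum>j<n. cnj (x $ i) * of_real (A $$ (i, j)) * x $ j)"
  define N where "N = (\<Sum>i<n. (cmod (x $ i))\<^sup>2)"
  have row: "(\<Sum>j<n. of_real (A $$ (i, j)) * x $ j) = c * x $ i" if "i < n" for i
  proof -
    have "(\<Sum>j<n. of_real (A $$ (i, j)) * x $ j) = (map_mat complex_of_real A *\<^sub>v x) $ i"
      using A x that by (simp add: scalar_prod_def atLeast0LessThan)
    also have "\<dots> = c * x $ i" using x that by (simp add: eq)
    finally show ?thesis .
  qed
  have "Q = (\<Sum>i<n. cnj (x $ i) * (c * x $ i))"
    unfolding Q_def by (simp add: mult.assoc sum_distrib_left[symmetric] row)
  also have "\<dots> = c * of_real N"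
    unfolding N_def of_real_sum sum_distrib_left
    by (intro sum.cong refl) (simp only: complex_norm_square mult_ac)
  finally have QN: "Q = c * of_real N" .
  have "cnj Q = (\<Sum>i<n. \<Sum>j<n. cnj (x $ j) * of_real (A $$ (j, i)) * x $ i)"
    unfolding Q_def by (auto simp: sym mult_ac intro!: sum.cong)
  also have "\<dots> = Q"
    unfolding Q_def by (rule sum.swap)
  finally have "cnj Q = Q" .
  obtain i where i: "i < n" "x $ i \<noteq> 0"
    using x by (metis carrier_vecD eq_vecI index_zero_vec)
  have "N \<noteq> 0"
    unfolding N_def using i by (subst sum_nonneg_eq_0_iff) auto
  with \<open>cnj Q = Q\<close> have "cnj c = c"
    by (simp add: QN)
  then show ?thesis by (simp add: Reals_cnj_iff)
qed

lemma proots_prod_linear: "proots (\<Prod>a\<leftarrow>as. [:- a, 1:]) = mset (as :: 'a::idom list)"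
proof (induction as)
  case (Cons a as)
  have "(\<Prod>a\<leftarrow>as. [:- a, 1:]) \<noteq> 0" by (auto simp: prod_list_zero_iff)
  then show ?case using Cons by (simp add: proots_mult del: mult_pCons_left)
qed simp

lemma size_adjacency_eigenvalues: "size (adjacency_eigenvalues n v E S) = n"
proof -
  interpret P: map_poly_comm_ring_hom complex_of_real ..
  define A where "A = adjacency_matrix n v E S"
  have A: "A \<in> carrier_mat n n" unfolding A_def by (rule adjacency_matrix_carrier)
  let ?C = "map_mat complex_of_real A"
  have C: "?C \<in> carrier_mat n n" using A by simp
  from char_poly_factorized[OF C] obtain as where
    as: "char_poly ?C = (\<Prod>a\<leftarrow>as. [:- a, 1:])" "length as = n" by blast
  have "a \<in> \<real>" if "a \<in> set as" for a
  proof (rule symmetric_eigenvalue_real[OF A])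
    show "eigenvalue ?C a"
      using that unfolding eigenvalue_root_char_poly[OF C] as(1) poly_prod_list
      by (auto simp: prod_list_zero_iff)
  qed (simp add: A_def adjacency_matrix_symmetric)
  then have "map (complex_of_real \<circ> Re) as = as"
    by (intro map_idI) (simp add: of_real_Re)
  then have as': "as = map complex_of_real (map Re as)" by simp
  have "map_poly complex_of_real (char_poly A) = char_poly ?C"
    by (rule of_real_hom.char_poly_hom[OF A, symmetric])
  also have "\<dots> = (\<Prod>a\<leftarrow>map Re as. map_poly complex_of_real [:- a, 1:])"
    by (subst as(1), subst as') (simp add: o_def)
  also have "\<dots> = map_poly complex_of_real (\<Prod>a\<leftarrow>map Re as. [:- a, 1:])"
    by (induction as) (simp_all add: P.hom_mult del: mult_pCons_left)
  finally have "char_poly A = (\<Prod>a\<leftarrow>map Re as. [:- a, 1:])"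
    by (simp add: poly_eq_iff coeff_map_poly)
  then show ?thesis
    unfolding adjacency_eigenvalues_def A_def[symmetric] by (simp only: proots_prod_linear size_mset length_map as)
qed

end

theory Submission
  imports Defs "Jordan_Normal_Form.Schur_Decomposition"
begin

text \<open>
  The deviations \<open>a\<^sub>i = \<bar>\<lambda>\<^sub>i - \<sigma>/n\<bar>\<close> satisfy \<open>\<Sum> a\<^sub>i\<^sup>2 = 2m + \<sigma> - \<sigma>\<^sup>2/n\<close>, because
  \<open>\<Sum> \<lambda>\<^sub>i\<close> and \<open>\<Sum> \<lambda>\<^sub>i\<^sup>2\<close> are the traces of \<open>A\<close> and \<open>A\<^sup>2\<close>.  The bound then says that
  the variance sum \<open>\<Sum> (a\<^sub>i - \<mu>)\<^sup>2\<close> about the mean \<open>\<mu>\<close> is at least the contribution of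
  its first and last terms, and \<open>(a\<^sub>1 - \<mu>)\<^sup>2 + (a\<^sub>n - \<mu>)\<^sup>2 \<ge> (a\<^sub>1 - a\<^sub>n)\<^sup>2 / 2\<close>.
\<close>

text \<open>\<open>card I\<close> times the variance sum about the mean \<mu> equals
  \<open>card I\<close> times the sum of squares minus the square of the sum, so a lower bound on
  the variance sum suffices. For \<open>p = q\<close> this is the Cauchy-Schwarz inequality.\<close>

lemma sum_squared_le:
  fixes a :: "'i \<Rightarrow> real"
  assumes "finite I" "p \<in> I" "q \<in> I"
  shows "(\<Sum>i\<in>I. a i)\<^sup>2 \<le> card I * (\<Sum>i\<in>I. (a i)\<^sup>2) - card I / 2 * (a p - a q)\<^sup>2"
proof -
  define N where "N = real (card I)"
  have "N > 0" unfolding N_def using assms by (auto simp: card_gt_0_iff)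
  define \<mu> where "\<mu> = (\<Sum>i\<in>I. a i) / N"
  have sum: "(\<Sum>i\<in>I. a i) = N * \<mu>" using \<open>N > 0\<close> by (simp add: \<mu>_def)
  have "(a p - a q)\<^sup>2 / 2 \<le> (\<Sum>i\<in>I. (a i - \<mu>)\<^sup>2)"
  proof (cases "p = q")
    case False
    have "(a p - a q)\<^sup>2 / 2 \<le> (a p - \<mu>)\<^sup>2 + (a q - \<mu>)\<^sup>2"
      \<comment> \<open>The right side exceeds the left by exactly half of this square.\<close>
      using zero_le_power2[of "a p + a q - 2 * \<mu>"] by (simp add: power2_eq_square field_simps)
    also have "\<dots> = (\<Sum>i\<in>{p, q}. (a i - \<mu>)\<^sup>2)" using False by simp
    also have "\<dots> \<le> (\<Sum>i\<in>I. (a i - \<mu>)\<^sup>2)"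
      using assms by (intro sum_mono2) auto
    finally show ?thesis .
  qed (simp add: sum_nonneg)
  also have "\<dots> = (\<Sum>i\<in>I. (a i)\<^sup>2) - 2 * \<mu> * (\<Sum>i\<in>I. a i) + N * \<mu>\<^sup>2"
    by (simp add: power2_diff sum.distrib sum_subtractf sum_distrib_left N_def) (simp add: mult_ac)
  also have "\<dots> = (\<Sum>i\<in>I. (a i)\<^sup>2) - N * \<mu>\<^sup>2"
    by (simp add: sum power2_eq_square)
  finally have "N * ((a p - a q)\<^sup>2 / 2) \<le> N * ((\<Sum>i\<in>I. (a i)\<^sup>2) - N * \<mu>\<^sup>2)"
    using \<open>N > 0\<close> by (intro mult_left_mono) auto
  then show ?thesis
    unfolding sum N_def[symmetric]
    by (simp add: power_mult_distrib power2_eq_square[of N] right_diff_distrib mult.assoc)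
qed

text \<open>Each root splits off a linear factor, and the quotient is again monic with as many roots
  as its degree, so induction on the root multiset applies. This turns a mere count of the
  eigenvalues into a factorization of the characteristic polynomial.\<close>

lemma monic_split_eq_prod_proots:
  fixes p :: "'a::idom poly"
  assumes "lead_coeff p = 1" "size (proots p) = degree p"
  shows "p = (\<Prod>a\<in>#proots p. [:- a, 1:])"
  using assms
proof (induction "proots p" arbitrary: p)
  case empty
  then have "degree p = 0" by (metis size_empty)
  then have "p = 1" using empty.prems by (metis lead_coeff_1 degree_0_id of_nat_1 coeff_pCons_0 degree_eq_zeroE pCons_one)
  then show ?case by simp
next
  case (add a M)
  have "p \<noteq> 0" using add.prems by auto
  then have "poly p a = 0" using add.hyps(2) by (metis set_count_proots mem_Collect_eq union_single_eq_member)
  then obtain q where q: "p = [:- a, 1:] * q" using poly_eq_0_iff_dvd by (metis dvdE)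
  with \<open>p \<noteq> 0\<close> have "q \<noteq> 0" by auto
  then have roots: "proots p = add_mset a (proots q)"
    unfolding q by (subst proots_mult) (auto simp del: mult_pCons_left)
  have "degree p = Suc (degree q)"
    using \<open>q \<noteq> 0\<close> unfolding q by (subst degree_mult_eq) auto
  moreover have "lead_coeff q = 1"
    using add.prems(1) unfolding q by (simp add: lead_coeff_mult del: mult_pCons_left)
  ultimately have "q = (\<Prod>a\<in>#proots q. [:- a, 1:])"
    using add roots by (intro add.hyps(1)) auto
  then show ?case using q roots by (metis image_mset_add_mset prod_mset.add_mset)
qed

definition mat_trace :: "'a::comm_monoid_add mat \<Rightarrow> 'a" where
  "mat_trace A = (\<Sum>i<dim_row A. A $$ (i, i))"

lemma mat_trace_mult:
  assumes "A \<in> carrier_mat n m" "B \<in> carrier_mat m n"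
  shows "mat_trace (A * B) = (\<Sum>i<n. \<Sum>j<m. A $$ (i, j) * B $$ (j, i))"
  using assms by (simp add: mat_trace_def scalar_prod_def atLeast0LessThan)

lemma mat_trace_mult_commute:
  fixes A B :: "'a::comm_semiring_0 mat"
  assumes "A \<in> carrier_mat n m" "B \<in> carrier_mat m n"
  shows "mat_trace (A * B) = mat_trace (B * A)"
  unfolding mat_trace_mult[OF assms] mat_trace_mult[OF assms(2,1)]
  by (subst sum.swap) (simp add: mult.commute)

text \<open>Cyclicity of the trace moves \<open>Q\<close> to the front of \<open>P * B * Q\<close>,
  where it cancels against \<open>P\<close>.\<close>

lemma mat_trace_similar:
  fixes A :: "'a::comm_ring_1 mat"
  assumes "A \<in> carrier_mat n n" "similar_mat_wit A B P Q"
  shows "mat_trace A = mat_trace B"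
proof -
  note [simp] = similar_mat_witD2(2,5-7)[OF assms]
  have "mat_trace A = mat_trace (P * B * Q)"
    using similar_mat_witD2(3)[OF assms] by simp
  also have "\<dots> = mat_trace (Q * (P * B))"
    by (rule mat_trace_mult_commute[where n = n and m = n]) (auto intro!: mult_carrier_mat[where n = n])
  also have "Q * (P * B) = Q * P * B"
    by (rule assoc_mult_mat[symmetric, where n\<^sub>1 = n and n\<^sub>2 = n and n\<^sub>3 = n and n\<^sub>4 = n]) simp_all
  also have "\<dots> = B" by (simp add: left_mult_one_mat[where nr = n and nc = n])
  finally show ?thesis .
qed

text \<open>For \<open>i \<noteq> j\<close> one of the entries at \<open>(i, j)\<close> and
  \<open>(j, i)\<close> lies below the diagonal, so only the diagonal terms of the double sum
  survive.\<close>

lemma mat_trace_square_upper_triangular: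
  fixes B :: "'a::semiring_1 mat"
  assumes B: "B \<in> carrier_mat n n" and ut: "upper_triangular B"
  shows "mat_trace (B * B) = (\<Sum>i<n. (B $$ (i, i))\<^sup>2)"
proof -
  have "B $$ (i, j) * B $$ (j, i) = (if j = i then (B $$ (i, i))\<^sup>2 else 0)"
    if "i < n" "j < n" for i j
    using that B upper_triangularD[OF ut, of i j] upper_triangularD[OF ut, of j i]
    by (cases i j rule: linorder_cases) (auto simp: power2_eq_square)
  then show ?thesis
    unfolding mat_trace_mult[OF B B] by simp
qed

text \<open>Schur decomposition makes \<open>A\<close> similar to an upper triangular
  \<open>B\<close> with diagonal \<open>as\<close>. The same \<open>P\<close> and \<open>Q\<close>
  make \<open>A * A\<close> similar to \<open>B * B\<close>, and similarity preserves
  traces.\<close>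

lemma mat_trace_sum_eigenvalues:
  fixes A :: "'a::conjugatable_ordered_field mat"
  assumes A: "A \<in> carrier_mat n n"
    and cp: "char_poly A = (\<Prod>a\<leftarrow>as. [:- a, 1:])"
  shows "mat_trace A = (\<Sum>a\<leftarrow>as. a)" "mat_trace (A * A) = (\<Sum>a\<leftarrow>as. a\<^sup>2)"
proof -
  obtain B P Q where BPQ: "schur_decomposition A as = (B, P, Q)"
    by (metis prod_cases3)
  from schur_decomposition[OF A cp this]
  have sim: "similar_mat_wit A B P Q" and ut: "upper_triangular B" and as: "diag_mat B = as"
    by auto
  have B: "B \<in> carrier_mat n n" using similar_mat_witD2[OF A sim] by blast
  have diag: "(\<Sum>a\<leftarrow>as. f a) = (\<Sum>i<n. f (B $$ (i, i)))" for f :: "'a \<Rightarrow> 'a"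
    unfolding as[symmetric] diag_mat_def
    using carrier_matD(1)[OF B] by (simp add: interv_sum_list_conv_sum_set_nat o_def atLeast0LessThan)
  show "mat_trace A = (\<Sum>a\<leftarrow>as. a)"
    unfolding diag mat_trace_similar[OF A sim] using B by (simp add: mat_trace_def)
  have "similar_mat_wit (A * A) (B * B) P Q"
    using similar_mat_wit_pow[OF sim, of 2] A B by (simp add: numeral_2_eq_2)
  then have "mat_trace (A * A) = mat_trace (B * B)"
    using A by (intro mat_trace_similar[of _ n]) auto
  then show "mat_trace (A * A) = (\<Sum>a\<leftarrow>as. a\<^sup>2)"
    unfolding diag mat_trace_square_upper_triangular[OF B ut] .
qed

lemma sum_adjacency_eigenvalues:
  fixes n :: nat and v :: "nat \<Rightarrow> 'a" and E :: "'a set set" and S :: "'a set"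
  defines "A \<equiv> adjacency_matrix n v E S"
  shows "(\<Sum>x\<in>#adjacency_eigenvalues n v E S. x) = mat_trace A"
    and "(\<Sum>x\<in>#adjacency_eigenvalues n v E S. x\<^sup>2) = mat_trace (A * A)"
proof -
  have A: "A \<in> carrier_mat n n" unfolding A_def by (rule adjacency_matrix_carrier)
  let ?M = "adjacency_eigenvalues n v E S"
  \<comment> \<open>Schur decomposition takes the eigenvalues as a list; any ordering of the
    multiset will do.\<close>
  obtain as where as: "mset as = ?M" using ex_mset by blast
  have "char_poly A = (\<Prod>a\<in>#?M. [:- a, 1:])"
    unfolding adjacency_eigenvalues_def A_def[symmetric]
  proof (rule monic_split_eq_prod_proots)
    show "lead_coeff (char_poly A) = 1" using degree_monic_char_poly[OF A] by simp
    show "size (proots (char_poly A)) = degree (char_poly A)"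
      using degree_monic_char_poly[OF A] size_adjacency_eigenvalues[of n v E S]
      by (simp add: adjacency_eigenvalues_def A_def)
  qed
  also have "\<dots> = (\<Prod>a\<leftarrow>as. [:- a, 1:])"
    unfolding as[symmetric] mset_map[symmetric] by (rule prod_mset_prod_list)
  finally have cp: "char_poly A = (\<Prod>a\<leftarrow>as. [:- a, 1:])" .
  have "(\<Sum>x\<in>#?M. f x) = (\<Sum>a\<leftarrow>as. f a)" for f :: "real \<Rightarrow> real"
    unfolding as[symmetric] mset_map[symmetric] by (rule sum_mset_sum_list)
  from this[of "\<lambda>x. x"] this[of "\<lambda>x. x\<^sup>2"]
  show "(\<Sum>x\<in>#?M. x) = mat_trace A" "(\<Sum>x\<in>#?M. x\<^sup>2) = mat_trace (A * A)"
    using mat_trace_sum_eigenvalues[OF A cp] by simp_all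
qed

text \<open>Double counting: every edge has two distinct endpoints, hence arises from exactly two
  ordered pairs of vertices.\<close>

lemma handshake:
  assumes "simple_graph V E"
  shows "(\<Sum>x\<in>V. \<Sum>y\<in>V. of_bool ({x, y} \<in> E)) = 2 * real (card E)"
proof -
  have V: "finite V" and e: "\<And>e. e \<in> E \<Longrightarrow> e \<subseteq> V" "\<And>e. e \<in> E \<Longrightarrow> card e = 2"
    using assms by (auto simp: simple_graph_def)
  have "finite E" using V e(1) by (meson PowI finite_Pow_iff finite_subset subsetI)
  have "(\<Sum>x\<in>V. \<Sum>y\<in>V. of_bool ({x, y} \<in> E)) = (\<Sum>z\<in>V \<times> V. of_bool ({fst z, snd z} \<in> E) :: real)"
    by (simp add: sum.cartesian_product split_def)
  \<comment> \<open>Membership in \<open>E\<close> is written as a sum over the edges, so that the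
    order of summation can be exchanged.\<close>
  also have "\<dots> = (\<Sum>z\<in>V \<times> V. \<Sum>e\<in>E. of_bool ({fst z, snd z} = e))"
    using \<open>finite E\<close> by (simp add: of_bool_def)
  also have "\<dots> = (\<Sum>e\<in>E. \<Sum>z\<in>V \<times> V. of_bool ({fst z, snd z} = e))"
    by (rule sum.swap)
  also have "\<dots> = (\<Sum>e\<in>E. 2)"
  proof (rule sum.cong[OF refl])
    fix e assume "e \<in> E"
    then obtain x y where xy: "e = {x, y}" "x \<noteq> y" using e(2) card_2_iff by metis
    have "(\<Sum>z\<in>V \<times> V. of_bool ({fst z, snd z} = e) :: real) = card {z \<in> V \<times> V. {fst z, snd z} = e}"
      using V by (simp add: of_bool_def sum.If_cases Int_def)
    also have "{z \<in> V \<times> V. {fst z, snd z} = e} = {(x, y), (y, x)}"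
      using e(1)[OF \<open>e \<in> E\<close>] xy by (auto simp: doubleton_eq_iff)
    finally show "(\<Sum>z\<in>V \<times> V. of_bool ({fst z, snd z} = e) :: real) = 2" using xy by simp
  qed
  finally show ?thesis by simp
qed

text \<open>The matrix is symmetric with entries 0 and 1, so the trace of its square is the sum of
  all its entries: the loops on the diagonal, and each edge twice off it.\<close>

lemma adjacency_matrix_traces:
  fixes v :: "nat \<Rightarrow> 'a"
  assumes G: "simple_graph V E" and v: "bij_betw v {1..n} V" and S: "S \<subseteq> V"
  defines "A \<equiv> adjacency_matrix n v E S"
  shows "mat_trace A = card S" "mat_trace (A * A) = 2 * card E + card S"
proof -
  have A: "A \<in> carrier_mat n n" unfolding A_def by (rule adjacency_matrix_carrier)
  have "finite V" using G by (simp add: simple_graph_def)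
  \<comment> \<open>Matrix indices start at 0 but the enumeration \<open>v\<close> starts at 1;
    composing with \<open>Suc\<close> turns sums over rows into sums over vertices.\<close>
  have Suc: "bij_betw Suc {..<n} {1..n}"
    by (rule bij_betw_byWitness[where f' = "\<lambda>i. i - 1"]) auto
  have reindex: "(\<Sum>i<n. f (v (Suc i))) = (\<Sum>x\<in>V. f x)" for f :: "'a \<Rightarrow> real"
    using sum.reindex_bij_betw[OF bij_betw_trans[OF Suc v], of f] by simp
  have loops: "(\<Sum>i<n. of_bool (v (Suc i) \<in> S)) = real (card S)"
    unfolding reindex[of "\<lambda>x. of_bool (x \<in> S)"] using S \<open>finite V\<close>
    by (simp add: of_bool_def sum.If_cases Int_absorb1)
  show "mat_trace A = card S"
    unfolding loops[symmetric] mat_trace_def A_def adjacency_matrix_def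
    by (simp add: of_bool_def)
  \<comment> \<open>Singletons are not edges, so the edge indicator vanishes on the diagonal and a
    single formula covers all entries.\<close>
  have no_loop: "{x, x} \<notin> E" for x using G by (auto simp: simple_graph_def)
  have entry: "A $$ (i, j) * A $$ (j, i) =
      (if j = i then of_bool (v (Suc i) \<in> S) else 0) + of_bool ({v (Suc i), v (Suc j)} \<in> E)"
    if "i < n" "j < n" for i j
    using that no_loop by (auto simp: A_def adjacency_matrix_def insert_commute)
  have "mat_trace (A * A) = (\<Sum>i<n. of_bool (v (Suc i) \<in> S)) +
      (\<Sum>i<n. \<Sum>j<n. of_bool ({v (Suc i), v (Suc j)} \<in> E))"
    unfolding mat_trace_mult[OF A A] by (simp add: entry sum.distrib)
  also have "(\<Sum>i<n. \<Sum>j<n. of_bool ({v (Suc i), v (Suc j)} \<in> E)) =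
      (\<Sum>x\<in>V. \<Sum>y\<in>V. of_bool ({x, y} \<in> E) :: real)"
    by (simp only: reindex[of "\<lambda>y. of_bool ({v (Suc _), y} \<in> E)"]
        reindex[of "\<lambda>x. \<Sum>y\<in>V. of_bool ({x, y} \<in> E)"])
  finally show "mat_trace (A * A) = 2 * card E + card S"
    by (simp add: loops handshake[OF G])
qed

theorem theorem2:
  fixes V S :: "'a set" and E :: "'a set set" and v :: "nat \<Rightarrow> 'a"
    and n m \<sigma> :: nat and ev :: "nat \<Rightarrow> real"
  assumes "simple_graph V E"
    and "bij_betw v {1..n} V"
    and "n \<ge> 2"
    and "card E = m"
    and "S \<subseteq> V"
    and "card S = \<sigma>"
    and "image_mset ev (mset_set {1..n}) = adjacency_eigenvalues n v E S"
    and "\<And>i j. 1 \<le> i \<Longrightarrow> i \<le> j \<Longrightarrow> j \<le> n \<Longrightarrow>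
           \<bar>ev i - real \<sigma> / real n\<bar> \<ge> \<bar>ev j - real \<sigma> / real n\<bar>"
  shows "energy n v E S \<le>
    sqrt (real n * (2 * real m + real \<sigma> - (real \<sigma>)\<^sup>2 / real n)
          - real n / 2 * (\<bar>ev 1 - real \<sigma> / real n\<bar> - \<bar>ev n - real \<sigma> / real n\<bar>)\<^sup>2)"
proof -
  define c where "c = real \<sigma> / real n"
  have sum_ev: "(\<Sum>x\<in>#adjacency_eigenvalues n v E S. f x) = (\<Sum>i\<in>{1..n}. f (ev i))"
    for f :: "real \<Rightarrow> real"
    unfolding assms(7)[symmetric] by (simp add: sum_unfold_sum_mset image_mset.compositionality o_def)
  have s1: "(\<Sum>i\<in>{1..n}. ev i) = \<sigma>" and s2: "(\<Sum>i\<in>{1..n}. (ev i)\<^sup>2) = 2 * m + \<sigma>"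
    using sum_adjacency_eigenvalues[of n v E S] adjacency_matrix_traces[OF assms(1,2,5)]
      assms(4,6) sum_ev[of "\<lambda>x. x"] sum_ev[of "\<lambda>x. x\<^sup>2"] by simp_all
  have "(\<Sum>i\<in>{1..n}. \<bar>ev i - c\<bar>\<^sup>2) =
      (\<Sum>i\<in>{1..n}. (ev i)\<^sup>2) - 2 * c * (\<Sum>i\<in>{1..n}. ev i) + n * c\<^sup>2"
    by (simp add: power2_diff sum.distrib sum_subtractf sum_distrib_left) (simp add: mult_ac)
  \<comment> \<open>The linear term contributes \<open>- 2 * \<sigma>\<^sup>2 / n\<close> and the
    constant term \<open>\<sigma>\<^sup>2 / n\<close>.\<close>
  also have "\<dots> = 2 * real m + real \<sigma> - (real \<sigma>)\<^sup>2 / real n"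
    unfolding s1 s2 c_def using assms(3) by (simp add: field_simps power2_eq_square)
  finally have squares: "(\<Sum>i\<in>{1..n}. \<bar>ev i - c\<bar>\<^sup>2) = \<dots>" .
  have "energy n v E S = (\<Sum>i\<in>{1..n}. \<bar>ev i - c\<bar>)"
    unfolding energy_def assms(6) c_def by (rule sum_ev)
  then have "(energy n v E S)\<^sup>2 \<le> real n * (2 * real m + real \<sigma> - (real \<sigma>)\<^sup>2 / real n)
      - real n / 2 * (\<bar>ev 1 - c\<bar> - \<bar>ev n - c\<bar>)\<^sup>2"
    \<comment> \<open>The two singled-out terms are the deviations at indices \<open>1\<close> and
      \<open>n\<close>.\<close>
    using sum_squared_le[of "{1..n}" 1 n "\<lambda>i. \<bar>ev i - c\<bar>"] assms(3)
    unfolding squares by simp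
  then show ?thesis unfolding c_def by (rule real_le_rsqrt)
qed

end
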